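(* Let $n_x,n_y\ge 1$, $n=n_x+n_y$, let $A\in\mathbb{R}^{n\times n}$ be symmetric positive definite, $b\in\mathbb{R}^n$, $c\in\mathbb{R}$, and consider the unconstrained quadratic optimization problem $\min_{z\in\mathbb{R}^n}J(z)$ with $J(z)=\frac12 z^\top A z-b^\top z+c$. Split $z=(x,y)$ with $x\in\mathbb{R}^{n_x}$, $y\in\mathbb{R}^{n_y}$, and correspondingly $$A=\begin{pmatrix} A_{11} & A_{12} \\ A_{21} & A_{22} \end{pmatrix},\qquad b=\begin{pmatrix} b_1 \\ b_2 \end{pmatrix},$$ with $A_{11}\in\mathbb{R}^{n_x\times n_x}$ and $A_{22}\in\mathbb{R}^{n_y\times n_y}$. Let $h(x)=-A_{22}^{-1}A_{21}x+A_{22}^{-1}b_2$ be the unique solution $y$ of $\nabla_y J(x,y)=0$, and let $\widetilde J(x)=J(x,h(x))$ be the reduced cost function, which is quadratic with Hessian the Schur complement $S=A_{11}-A_{12}A_{22}^{-1}A_{21}$. Then the right preconditioned gradient descent method (gradient descent applied to $\widetilde J$) always has a better asymptotic convergence rate than the standard gradient descent method (gradient descent applied to $J$).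
   Context: For a symmetric positive definite matrix $M$, $\kappa_2(M)=\lambda_{\max}(M)/\lambda_{\min}(M)$ denotes its spectral condition number. Gradient descent (GD) applied to a differentiable function $f$ generates iterates $w^{k+1}=w^k-t_k\nabla f(w^k)$ with step lengths $t_k>0$. The right preconditioned gradient descent (PGD) method is GD applied to the reduced cost function $\widetilde J$ in place of $J$. For a quadratic function $f$ with symmetric positive definite Hessian $M$ and minimizer $w^\star$, GD with the optimal step length satisfies the classical estimate $$\|w^k-w^\star\|_2\le\sqrt{\kappa_2(M)}\left(\frac{\kappa_2(M)-1}{\kappa_2(M)+1}\right)^k\|w^0-w^\star\|_2.$$ The asymptotic convergence rate of GD on such a function means the factor $\frac{\kappa_2(M)-1}{\kappa_2(M)+1}$ in this estimate, a smaller factor being a better rate. Thus the rate of standard GD on $J$ is the factor with $M=A$, and the rate of PGD is the factor with $M=S$.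
   Formalization: "Better asymptotic convergence rate" is proved as "at least as good" (factor for S at most the factor for A); a strictly better rate fails in general, e.g. for A = I, where both factors are 0. *)

theory Defs
  imports "HOL-Analysis.Analysis"
begin

definition sym_pos_def :: "real^'a^'a \<Rightarrow> bool" where
  "sym_pos_def M \<longleftrightarrow> transpose M = M \<and> (\<forall>v. v \<noteq> 0 \<longrightarrow> 0 < v \<bullet> (M *v v))"

definition eigenvals :: "real^'a^'a \<Rightarrow> real set" where
  "eigenvals M = {l. \<exists>v. v \<noteq> 0 \<and> M *v v = l *\<^sub>R v}"

definition lambda_max :: "real^'a^'a \<Rightarrow> real" where
  "lambda_max M = Max (eigenvals M)"

definition lambda_min :: "real^'a^'a \<Rightarrow> real" where
  "lambda_min M = Min (eigenvals M)"

definition cond2 :: "real^'a^'a \<Rightarrow> real" where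
  "cond2 M = lambda_max M / lambda_min M"

definition quad_fun :: "real^'a^'a \<Rightarrow> real^'a \<Rightarrow> real \<Rightarrow> real^'a \<Rightarrow> real" where
  "quad_fun M g d z = 1/2 * (z \<bullet> (M *v z)) - g \<bullet> z + d"

definition is_quadratic :: "(real^'a \<Rightarrow> real) \<Rightarrow> bool" where
  "is_quadratic f \<longleftrightarrow> (\<exists>M g d. f = quad_fun M g d)"

definition has_hessian :: "(real^'a \<Rightarrow> real) \<Rightarrow> real^'a^'a \<Rightarrow> real^'a \<Rightarrow> bool" where
  "has_hessian f M w \<longleftrightarrow>
     (\<exists>grad. (\<forall>v. GDERIV f v :> grad v) \<and> (grad has_derivative (\<lambda>v. M *v v)) (at w))"

definition gd_factor :: "real^'a^'a \<Rightarrow> real" where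
  "gd_factor M = (cond2 M - 1) / (cond2 M + 1)"

text \<open>The asymptotic rate of gradient descent applied to a quadratic function f with
  symmetric positive definite Hessian M is, by convention, the factor
  \<open>(\<kappa> - 1) / (\<kappa> + 1)\<close> with \<open>\<kappa> = cond2 M\<close> from the classical estimate for the optimal
  step length.  The relation is functional in r because f determines its Hessian.\<close>

definition has_gd_rate :: "(real^'a \<Rightarrow> real) \<Rightarrow> real \<Rightarrow> bool" where
  "has_gd_rate f r \<longleftrightarrow>
     is_quadratic f \<and> (\<exists>M. sym_pos_def M \<and> (\<forall>w. has_hessian f M w) \<and> r = gd_factor M)"

text \<open>Block vectors and matrices: the index type is a sum type, with \<open>Inl\<close> marking the
  x-components and \<open>Inr\<close> the y-components, so \<open>n = CARD('m) + CARD('n)\<close>.\<close>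

definition join :: "real^'m \<Rightarrow> real^'n \<Rightarrow> real^('m::finite + 'n::finite)" where
  "join x y = (\<chi> i. case i of Inl j \<Rightarrow> x $ j | Inr k \<Rightarrow> y $ k)"

definition block11 :: "real^('m::finite + 'n::finite)^('m + 'n) \<Rightarrow> real^'m^'m" where
  "block11 A = (\<chi> i j. A $ Inl i $ Inl j)"

definition block12 :: "real^('m::finite + 'n::finite)^('m + 'n) \<Rightarrow> real^'n^'m" where
  "block12 A = (\<chi> i j. A $ Inl i $ Inr j)"

definition block21 :: "real^('m::finite + 'n::finite)^('m + 'n) \<Rightarrow> real^'m^'n" where
  "block21 A = (\<chi> i j. A $ Inr i $ Inl j)"

definition block22 :: "real^('m::finite + 'n::finite)^('m + 'n) \<Rightarrow> real^'n^'n" where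
  "block22 A = (\<chi> i j. A $ Inr i $ Inr j)"

definition lower_part :: "real^('m::finite + 'n::finite) \<Rightarrow> real^'n" where
  "lower_part b = (\<chi> i. b $ Inr i)"

definition inner_sol :: "real^('m::finite + 'n::finite)^('m + 'n) \<Rightarrow> real^('m + 'n) \<Rightarrow> real^'m \<Rightarrow> real^'n" where
  "inner_sol A b x =
     - (matrix_inv (block22 A) *v (block21 A *v x)) + matrix_inv (block22 A) *v lower_part b"

definition reduced_cost ::
  "real^('m::finite + 'n::finite)^('m + 'n) \<Rightarrow> real^('m + 'n) \<Rightarrow> real \<Rightarrow> real^'m \<Rightarrow> real" where
  "reduced_cost A b c x = quad_fun A b c (join x (inner_sol A b x))"

definition schur_compl :: "real^('m::finite + 'n::finite)^('m + 'n) \<Rightarrow> real^'m^'m" where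
  "schur_compl A = block11 A - block12 A ** matrix_inv (block22 A) ** block21 A"

end

theory Submission
  imports Defs
begin

text \<open>
  Minimizing \<open>J\<close> over \<open>y\<close> for fixed \<open>x\<close> restricts the quadratic form of \<open>A\<close> to the graph of the
  linear map \<open>x \<mapsto> - A\<^sub>2\<^sub>2\<^sup>-\<^sup>1 A\<^sub>2\<^sub>1 x\<close>. Let \<open>E x\<close> be the point of this graph above \<open>x\<close>. The \<open>y\<close>-part of
  \<open>A (E x)\<close> vanishes and its \<open>x\<close>-part is \<open>S x\<close>; this single identity (\<open>matrix_mult_schur_extension\<close>)
  says that the graph is \<open>A\<close>-orthogonal to the subspace \<open>x = 0\<close>, and it carries everything.

  It gives \<open>x \<bullet> S x = E x \<bullet> A (E x)\<close>, so \<open>S\<close> inherits symmetry and definiteness from \<open>A\<close>, and the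
  cross terms vanish when \<open>J\<close> is expanded along the affine graph of \<open>h\<close>, so \<open>S\<close> is the Hessian of
  the reduced cost. It also bounds the form of \<open>S\<close> on both sides. From below,
  \<open>E x \<bullet> A (E x) \<ge> \<lambda>\<^sub>m\<^sub>i\<^sub>n(A) \<parallel>E x\<parallel>\<^sup>2 \<ge> \<lambda>\<^sub>m\<^sub>i\<^sub>n(A) \<parallel>x\<parallel>\<^sup>2\<close>. From above, \<open>E x\<close> minimizes the form of \<open>A\<close> among
  the points above \<open>x\<close>, so comparison with \<open>(x, 0)\<close> bounds the value by \<open>\<lambda>\<^sub>m\<^sub>a\<^sub>x(A) \<parallel>x\<parallel>\<^sup>2\<close>. By the
  variational description of the extreme eigenvalues (\<open>rayleigh_lambda_min\<close>, \<open>rayleigh_lambda_max\<close>)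
  the spectrum of \<open>S\<close> lies between the extreme eigenvalues of \<open>A\<close>. Hence \<open>\<kappa>\<^sub>2(S) \<le> \<kappa>\<^sub>2(A)\<close>, and the factor
  \<open>(\<kappa> - 1) / (\<kappa> + 1)\<close> is increasing in \<open>\<kappa>\<close>.
\<close>

section \<open>Extreme eigenvalues of symmetric matrices\<close>

lemma inner_matrix_vector_symmetric:
  fixes M :: "real^'a::finite^'a"
  assumes "transpose M = M"
  shows "v \<bullet> (M *v w) = (M *v v) \<bullet> w"
  by (metis assms dot_lmul_matrix transpose_matrix_vector)

lemma symmetric_matrixI:
  fixes M :: "real^'a::finite^'a"
  assumes "\<And>v w. v \<bullet> (M *v w) = (M *v v) \<bullet> w"
  shows "transpose M = M"
proof -
  have "transpose M *v v = M *v v" for v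
  proof -
    have "(transpose M *v v) \<bullet> w = (M *v v) \<bullet> w" for w
      using assms[of v w] by (simp add: dot_lmul_matrix)
    then show ?thesis
      by (metis vector_eq_rdot)
  qed
  then show ?thesis
    by (simp add: matrix_eq)
qed

lemma quadratic_form_add:
  fixes M :: "real^'a::finite^'a"
  assumes "transpose M = M"
  shows "(u + v) \<bullet> (M *v (u + v)) = u \<bullet> (M *v u) + 2 * (v \<bullet> (M *v u)) + v \<bullet> (M *v v)"
  using inner_matrix_vector_symmetric[OF assms, of u v]
  by (simp add: matrix_vector_right_distrib inner_add_left inner_add_right inner_commute)

text \<open>Eigenvectors for distinct eigenvalues are orthogonal, hence independent, so there are at most
  as many eigenvalues as dimensions.\<close>

lemma finite_eigenvals_symmetric:
  fixes M :: "real^'a::finite^'a"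
  assumes "transpose M = M"
  shows "finite (eigenvals M)"
proof -
  have "\<forall>l\<in>eigenvals M. \<exists>v. v \<noteq> 0 \<and> M *v v = l *\<^sub>R v"
    by (simp add: eigenvals_def)
  then obtain e where e: "\<And>l. l \<in> eigenvals M \<Longrightarrow> e l \<noteq> 0 \<and> M *v e l = l *\<^sub>R e l"
    by metis
  have orth: "e l \<bullet> e k = 0" if "l \<in> eigenvals M" "k \<in> eigenvals M" "l \<noteq> k" for l k
    using inner_matrix_vector_symmetric[OF assms, of "e l" "e k"] e[OF that(1)] e[OF that(2)] that(3)
    by simp
  have "inj_on e (eigenvals M)"
    by (rule inj_onI) (metis e orth inner_eq_zero_iff)
  moreover have "pairwise orthogonal (e ` eigenvals M)"
    using orth by (auto simp: pairwise_def orthogonal_def)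
  then have "independent (e ` eigenvals M)"
    by (rule pairwise_orthogonal_independent) (use e in auto)
  then have "finite (e ` eigenvals M)"
    by (rule independent_imp_finite)
  ultimately show ?thesis
    by (simp add: finite_image_iff)
qed

text \<open>The form attains its minimum \<open>0\<close> at \<open>u\<close>, so its gradient \<open>2 M u\<close> vanishes there.\<close>

lemma psd_form_zero_imp_kernel:
  fixes M :: "real^'a::finite^'a"
  assumes sym: "transpose M = M" and psd: "\<And>v. 0 \<le> v \<bullet> (M *v v)" and u: "u \<bullet> (M *v u) = 0"
  shows "M *v u = 0"
proof (rule ccontr)
  assume "M *v u \<noteq> 0"
  define w where "w = M *v u"
  define p q where "p = w \<bullet> w" and "q = w \<bullet> (M *v w)"
  have "p > 0" using \<open>M *v u \<noteq> 0\<close> by (simp add: p_def w_def)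
  have "q \<ge> 0" using psd by (simp add: q_def)
  \<comment> \<open>Along \<open>u + t w\<close> the form is \<open>2 t p + t\<^sup>2 q\<close>, negative for small \<open>t < 0\<close>; this \<open>t\<close> is small enough.\<close>
  define t where "t = - p / (q + 1)"
  have t: "t < 0" "t * (q + 1) = - p"
    using \<open>p > 0\<close> \<open>q \<ge> 0\<close> by (simp_all add: t_def divide_simps)
  have "0 \<le> 2 * t * p + t * t * q"
    using psd[of "u + t *\<^sub>R w"] u
    by (simp add: quadratic_form_add[OF sym] matrix_vector_mult_scaleR p_def q_def flip: w_def)
  also have "\<dots> = t * (2 * p + t * q)"
    by (simp add: algebra_simps)
  also have "t * q = - p - t"
    using t(2) by (simp add: algebra_simps)
  also have "t * (2 * p + (- p - t)) < 0"
    using t(1) \<open>p > 0\<close> by (intro mult_neg_pos) auto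
  finally show False by simp
qed

text \<open>A minimizer \<open>u\<close> of the form on the compact unit sphere, with value \<open>l\<close>, is a zero of the
  positive semidefinite form of \<open>M - l I\<close>.\<close>

lemma exists_minimal_eigenvalue:
  fixes M :: "real^'a::finite^'a"
  assumes sym: "transpose M = M"
  shows "\<exists>l\<in>eigenvals M. \<forall>v. l * (v \<bullet> v) \<le> v \<bullet> (M *v v)"
proof -
  have "continuous_on (sphere 0 1) (\<lambda>v. v \<bullet> (M *v v))"
    by (intro continuous_intros matrix_vector_mult_linear_continuous_on)
  then obtain u where u: "u \<in> sphere 0 1"
    and min: "\<And>v. v \<in> sphere 0 1 \<Longrightarrow> u \<bullet> (M *v u) \<le> v \<bullet> (M *v v)"
    using continuous_attains_inf[of "sphere 0 1" "\<lambda>v. v \<bullet> (M *v v)"] by auto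
  define l where "l = u \<bullet> (M *v u)"
  have bound: "l * (v \<bullet> v) \<le> v \<bullet> (M *v v)" for v
  proof (cases "v = 0")
    case False
    define s where "s = inverse (norm v)"
    have s: "s > 0" "s * s * (v \<bullet> v) = 1"
      using False by (simp_all add: s_def dot_square_norm power2_eq_square field_simps)
    have "l \<le> (s *\<^sub>R v) \<bullet> (M *v (s *\<^sub>R v))"
      unfolding l_def using False by (intro min) (simp add: s_def)
    also have "\<dots> = s * s * (v \<bullet> (M *v v))"
      by (simp add: matrix_vector_mult_scaleR)
    finally have "s * s * (l * (v \<bullet> v)) \<le> s * s * (v \<bullet> (M *v v))"
      using s(2) by (simp add: algebra_simps)
    then show ?thesis
      using s(1) by (simp add: mult_le_cancel_left_pos)
  qed simp
  define B where "B = M - l *\<^sub>R mat 1"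
  have B: "B *v v = M *v v - l *\<^sub>R v" for v
    by (simp add: B_def matrix_vector_mult_diff_rdistrib scaleR_matrix_vector_assoc[symmetric])
  have "transpose B = B"
    by (rule symmetric_matrixI)
      (simp add: B inner_diff_left inner_diff_right inner_matrix_vector_symmetric[OF sym])
  moreover have "u \<bullet> u = 1"
    using u by (simp add: dot_square_norm)
  ultimately have "B *v u = 0"
    using bound by (intro psd_form_zero_imp_kernel) (simp_all add: B inner_diff_right l_def)
  then have "u \<noteq> 0" "M *v u = l *\<^sub>R u"
    using \<open>u \<bullet> u = 1\<close> by (auto simp: B)
  then have "l \<in> eigenvals M"
    by (auto simp: eigenvals_def)
  with bound show ?thesis by blast
qed

lemma exists_maximal_eigenvalue:
  fixes M :: "real^'a::finite^'a"
  assumes sym: "transpose M = M"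
  shows "\<exists>l\<in>eigenvals M. \<forall>v. v \<bullet> (M *v v) \<le> l * (v \<bullet> v)"
proof -
  have neg: "(- M) *v v = - (M *v v)" for v
    using matrix_vector_mult_diff_rdistrib[of 0 M v] by simp
  have "transpose (- M) = - M"
    by (rule symmetric_matrixI) (simp add: neg inner_matrix_vector_symmetric[OF sym])
  then obtain l where l: "l \<in> eigenvals (- M)" "\<And>v. l * (v \<bullet> v) \<le> v \<bullet> ((- M) *v v)"
    using exists_minimal_eigenvalue by blast
  from l(1) have "- l \<in> eigenvals M"
    by (auto simp: eigenvals_def neg) (metis minus_equation_iff)
  moreover have "v \<bullet> (M *v v) \<le> - l * (v \<bullet> v)" for v
    using l(2)[of v] by (simp add: neg)
  ultimately show ?thesis by blast
qed

lemma eigenvalE: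
  assumes "l \<in> eigenvals M"
  obtains v where "v \<bullet> v > 0" "v \<bullet> (M *v v) = l * (v \<bullet> v)"
  using assms by (auto simp: eigenvals_def)

lemma rayleigh_lambda_min:
  fixes M :: "real^'a::finite^'a"
  assumes "transpose M = M"
  shows "lambda_min M \<in> eigenvals M" "lambda_min M * (v \<bullet> v) \<le> v \<bullet> (M *v v)"
proof -
  obtain l where l: "l \<in> eigenvals M" "\<And>v. l * (v \<bullet> v) \<le> v \<bullet> (M *v v)"
    using exists_minimal_eigenvalue[OF assms] by blast
  have "l \<le> k" if "k \<in> eigenvals M" for k
    using that by (rule eigenvalE) (metis l(2) mult_le_cancel_right_pos)
  then have "lambda_min M = l"
    unfolding lambda_min_def by (intro Min_eqI finite_eigenvals_symmetric assms l(1))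
  with l show "lambda_min M \<in> eigenvals M" "lambda_min M * (v \<bullet> v) \<le> v \<bullet> (M *v v)"
    by auto
qed

lemma rayleigh_lambda_max:
  fixes M :: "real^'a::finite^'a"
  assumes "transpose M = M"
  shows "lambda_max M \<in> eigenvals M" "v \<bullet> (M *v v) \<le> lambda_max M * (v \<bullet> v)"
proof -
  obtain l where l: "l \<in> eigenvals M" "\<And>v. v \<bullet> (M *v v) \<le> l * (v \<bullet> v)"
    using exists_maximal_eigenvalue[OF assms] by blast
  have "k \<le> l" if "k \<in> eigenvals M" for k
    using that by (rule eigenvalE) (metis l(2) mult_le_cancel_right_pos)
  then have "lambda_max M = l"
    unfolding lambda_max_def by (intro Max_eqI finite_eigenvals_symmetric assms l(1))
  with l show "lambda_max M \<in> eigenvals M" "v \<bullet> (M *v v) \<le> lambda_max M * (v \<bullet> v)"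
    by auto
qed

lemma lambda_min_pos:
  fixes M :: "real^'a::finite^'a"
  assumes "sym_pos_def M"
  shows "lambda_min M > 0"
proof -
  have "lambda_min M \<in> eigenvals M"
    using assms by (simp add: sym_pos_def_def rayleigh_lambda_min)
  then obtain v where "v \<bullet> v > 0" "v \<bullet> (M *v v) = lambda_min M * (v \<bullet> v)"
    by (rule eigenvalE)
  with assms show ?thesis
    by (metis sym_pos_def_def inner_gt_zero_iff zero_less_mult_pos2)
qed

lemma invertible_sym_pos_def:
  fixes M :: "real^'a::finite^'a"
  assumes "sym_pos_def M"
  shows "invertible M"
proof -
  have "v = 0" if "M *v v = 0" for v
    using assms that by (metis sym_pos_def_def inner_zero_right less_irrefl)
  then show ?thesis
    by (simp add: invertible_left_inverse matrix_left_invertible_ker)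
qed

lemma matrix_inv_cancel:
  fixes M :: "real^'a::finite^'a"
  assumes "invertible M"
  shows "M ** matrix_inv M = mat 1" "matrix_inv M ** M = mat 1"
proof -
  have "\<exists>N. M ** N = mat 1 \<and> N ** M = mat 1"
    using assms by (simp add: invertible_def)
  from someI_ex[OF this] show "M ** matrix_inv M = mat 1" "matrix_inv M ** M = mat 1"
    by (simp_all add: matrix_inv_def)
qed

lemma gd_factor_mono:
  fixes M :: "real^'a::finite^'a" and N :: "real^'b::finite^'b"
  assumes M: "sym_pos_def M" and N: "sym_pos_def N"
    and min: "lambda_min N \<le> lambda_min M" and max: "lambda_max M \<le> lambda_max N"
  shows "gd_factor M \<le> gd_factor N"
proof -
  have "lambda_max M \<ge> lambda_min M"
    unfolding lambda_min_def using M rayleigh_lambda_max(1)[of M]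
    by (intro Min_le finite_eigenvals_symmetric) (auto simp: sym_pos_def_def)
  then have pos: "lambda_max M > 0"
    using lambda_min_pos[OF M] by simp
  then have "cond2 M > 0"
    using lambda_min_pos[OF M] by (simp add: cond2_def)
  moreover have "cond2 M \<le> cond2 N"
    unfolding cond2_def using pos max min lambda_min_pos[OF N] by (intro frac_le) auto
  ultimately show ?thesis
    by (simp add: gd_factor_def divide_simps algebra_simps)
qed

section \<open>Quadratic functions\<close>

lemma GDERIV_quad_fun:
  fixes M :: "real^'a::finite^'a"
  assumes "transpose M = M"
  shows "GDERIV (quad_fun M g d) z :> M *v z - g"
proof -
  have "(quad_fun M g d has_derivative
      (\<lambda>h. 1/2 * (z \<bullet> (M *v h) + h \<bullet> (M *v z)) - g \<bullet> h)) (at z)"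
    unfolding quad_fun_def
    by (auto intro!: derivative_eq_intros bounded_linear.has_derivative[OF matrix_vector_mul_bounded_linear])
  moreover have "1/2 * (z \<bullet> (M *v h) + h \<bullet> (M *v z)) - g \<bullet> h = h \<bullet> (M *v z - g)" for h
    using inner_matrix_vector_symmetric[OF assms, of z h]
    by (simp add: inner_diff_right inner_commute)
  ultimately show ?thesis
    by (simp add: gderiv_def)
qed

lemma GDERIV_unique:
  assumes "GDERIV f x :> u" "GDERIV f x :> v"
  shows "u = v"
proof -
  have "(\<lambda>h. h \<bullet> u) = (\<lambda>h. h \<bullet> v)"
    using assms unfolding gderiv_def by (rule has_derivative_unique)
  then show ?thesis
    by (metis vector_eq_ldot)
qed

lemma has_hessian_quad_fun:
  fixes M :: "real^'a::finite^'a"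
  assumes "transpose M = M"
  shows "has_hessian (quad_fun M g d) M w"
proof -
  have "((\<lambda>z. M *v z - g) has_derivative (\<lambda>v. M *v v)) (at w)"
    by (auto intro!: derivative_eq_intros bounded_linear_imp_has_derivative)
  then show ?thesis
    unfolding has_hessian_def
    by (intro exI[of _ "\<lambda>z. M *v z - g"] conjI allI GDERIV_quad_fun[OF assms])
qed

lemma has_gd_rate_quad_fun:
  fixes M :: "real^'a::finite^'a"
  assumes "sym_pos_def M"
  shows "has_gd_rate (quad_fun M g d) (gd_factor M)"
  unfolding has_gd_rate_def is_quadratic_def
  using assms has_hessian_quad_fun[of M] by (auto simp: sym_pos_def_def)

section \<open>Block vectors and the Schur complement\<close>

lemma sum_over_sum_type:
  fixes f :: "'m::finite + 'n::finite \<Rightarrow> 'b::comm_monoid_add"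
  shows "(\<Sum>i\<in>UNIV. f i) = (\<Sum>j\<in>UNIV. f (Inl j)) + (\<Sum>k\<in>UNIV. f (Inr k))"
  by (simp add: UNIV_Plus_UNIV[symmetric] sum.Plus del: UNIV_Plus_UNIV)

lemma inner_join: "join x y \<bullet> join x' y' = x \<bullet> x' + y \<bullet> y'"
  by (simp add: inner_vec_def sum_over_sum_type join_def)

lemma join_add: "join x y + join x' y' = join (x + x') (y + y')"
  by (simp add: vec_eq_iff join_def split: sum.split)

lemma join_eq_0_iff: "join x y = 0 \<longleftrightarrow> x = 0 \<and> y = 0"
  by (metis inner_join inner_eq_zero_iff add_nonneg_eq_0_iff inner_ge_zero)

definition upper_part :: "real^('m::finite + 'n::finite) \<Rightarrow> real^'m" where
  "upper_part b = (\<chi> i. b $ Inl i)"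

lemma join_parts: "join (upper_part b) (lower_part b) = b"
  by (simp add: vec_eq_iff join_def upper_part_def lower_part_def split: sum.split)

lemma matrix_mult_join:
  "A *v join x y = join (block11 A *v x + block12 A *v y) (block21 A *v x + block22 A *v y)"
  by (simp add: vec_eq_iff matrix_vector_mult_def sum_over_sum_type join_def block11_def
      block12_def block21_def block22_def split: sum.split)

lemma sym_pos_def_block22:
  assumes "sym_pos_def A"
  shows "sym_pos_def (block22 A)"
proof -
  have "A $ j $ i = transpose A $ i $ j" for i j
    by (simp add: transpose_def)
  then have "A $ j $ i = A $ i $ j" for i j
    using assms unfolding sym_pos_def_def by simp
  then have "transpose (block22 A) = block22 A"
    by (simp add: transpose_def block22_def vec_eq_iff)
  moreover have "0 < y \<bullet> (block22 A *v y)" if "y \<noteq> 0" for y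
  proof -
    have "0 < join 0 y \<bullet> (A *v join 0 y)"
      using assms that by (simp add: sym_pos_def_def join_eq_0_iff)
    then show ?thesis
      by (simp add: matrix_mult_join inner_join)
  qed
  ultimately show ?thesis
    by (simp add: sym_pos_def_def)
qed

lemma matrix_inv_block22:
  assumes "sym_pos_def A"
  shows "block22 A *v (matrix_inv (block22 A) *v y) = y"
    and "matrix_inv (block22 A) *v (block22 A *v y) = y"
  using matrix_inv_cancel[OF invertible_sym_pos_def[OF sym_pos_def_block22[OF assms]]]
  by (simp_all add: matrix_vector_mul_assoc)

text \<open>The point above \<open>x\<close> at which the homogeneous form of \<open>A\<close> is minimal.\<close>

definition schur_extension ::
  "real^('m::finite + 'n::finite)^('m + 'n) \<Rightarrow> real^'m \<Rightarrow> real^('m + 'n)" where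
  "schur_extension A x = join x (- (matrix_inv (block22 A) *v (block21 A *v x)))"

text \<open>Block elimination: the choice of the \<open>y\<close>-part cancels the second block row of \<open>A\<close>, and
  substituting it into the first block row produces \<open>S\<close>.\<close>

lemma matrix_mult_schur_extension:
  assumes "sym_pos_def A"
  shows "A *v schur_extension A x = join (schur_compl A *v x) 0"
  by (simp add: schur_extension_def matrix_mult_join matrix_inv_block22[OF assms] schur_compl_def
      matrix_vector_mult_diff_rdistrib matrix_vector_mul_assoc[symmetric]
      linear_neg[OF matrix_vector_mul_linear])

lemma inner_schur_compl:
  assumes "sym_pos_def A"
  shows "x \<bullet> (schur_compl A *v x') = schur_extension A x \<bullet> (A *v schur_extension A x')"
  by (simp add: matrix_mult_schur_extension[OF assms] inner_join) (simp add: schur_extension_def inner_join)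

lemma sym_pos_def_schur_compl:
  assumes "sym_pos_def A"
  shows "sym_pos_def (schur_compl A)"
proof -
  have sym: "transpose A = A"
    using assms by (simp add: sym_pos_def_def)
  have "transpose (schur_compl A) = schur_compl A"
  proof (rule symmetric_matrixI)
    fix v w
    show "v \<bullet> (schur_compl A *v w) = (schur_compl A *v v) \<bullet> w"
      using inner_schur_compl[OF assms, of v w] inner_schur_compl[OF assms, of w v]
        inner_matrix_vector_symmetric[OF sym, of "schur_extension A v" "schur_extension A w"]
      by (simp add: inner_commute)
  qed
  moreover have "0 < v \<bullet> (schur_compl A *v v)" if "v \<noteq> 0" for v
    using assms that unfolding inner_schur_compl[OF assms]
    by (simp add: sym_pos_def_def schur_extension_def join_eq_0_iff)
  ultimately show ?thesis
    by (simp add: sym_pos_def_def)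
qed

text \<open>Passing from \<open>v\<close> to its extension preserves the form value and can only increase the norm.\<close>

lemma lambda_min_le_schur_compl:
  assumes "sym_pos_def A"
  shows "lambda_min A \<le> lambda_min (schur_compl A)"
proof -
  have "lambda_min (schur_compl A) \<in> eigenvals (schur_compl A)"
    using sym_pos_def_schur_compl[OF assms] by (simp add: sym_pos_def_def rayleigh_lambda_min)
  then obtain v where v: "v \<bullet> v > 0"
      "v \<bullet> (schur_compl A *v v) = lambda_min (schur_compl A) * (v \<bullet> v)"
    by (rule eigenvalE)
  let ?p = "schur_extension A v"
  have "lambda_min A * (v \<bullet> v) \<le> lambda_min A * (?p \<bullet> ?p)"
    using lambda_min_pos[OF assms] by (simp add: schur_extension_def inner_join)
  also have "\<dots> \<le> ?p \<bullet> (A *v ?p)"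
    using assms by (intro rayleigh_lambda_min(2)) (simp add: sym_pos_def_def)
  also have "\<dots> = lambda_min (schur_compl A) * (v \<bullet> v)"
    using v(2) by (simp add: inner_schur_compl[OF assms])
  finally show ?thesis
    using v(1) by (simp add: mult_le_cancel_right_pos)
qed

text \<open>The point \<open>(x, 0)\<close> differs from the extension of \<open>x\<close> by a vector \<open>(0, y)\<close>, which is
  \<open>A\<close>-orthogonal to it, so by Pythagoras the extension has the smaller form value.\<close>

lemma schur_compl_le_form:
  assumes "sym_pos_def A"
  shows "x \<bullet> (schur_compl A *v x) \<le> join x 0 \<bullet> (A *v join x 0)"
proof -
  define y where "y = matrix_inv (block22 A) *v (block21 A *v x)"
  have "join x 0 = schur_extension A x + join 0 y"
    by (simp add: schur_extension_def join_add y_def)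
  moreover have "transpose A = A" "0 \<le> join 0 y \<bullet> (A *v join 0 y)"
    using assms by (auto simp: sym_pos_def_def) (metis inner_zero_left less_eq_real_def)
  moreover have "join 0 y \<bullet> (A *v schur_extension A x) = 0"
    by (simp add: matrix_mult_schur_extension[OF assms] inner_join)
  ultimately show ?thesis
    by (simp add: quadratic_form_add inner_schur_compl[OF assms])
qed

lemma lambda_max_schur_compl_le:
  assumes "sym_pos_def A"
  shows "lambda_max (schur_compl A) \<le> lambda_max A"
proof -
  have "lambda_max (schur_compl A) \<in> eigenvals (schur_compl A)"
    using sym_pos_def_schur_compl[OF assms] by (simp add: sym_pos_def_def rayleigh_lambda_max)
  then obtain v where v: "v \<bullet> v > 0"
      "v \<bullet> (schur_compl A *v v) = lambda_max (schur_compl A) * (v \<bullet> v)"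
    by (rule eigenvalE)
  have "lambda_max (schur_compl A) * (v \<bullet> v) \<le> join v 0 \<bullet> (A *v join v 0)"
    using schur_compl_le_form[OF assms, of v] v(2) by simp
  also have "\<dots> \<le> lambda_max A * (v \<bullet> v)"
    using rayleigh_lambda_max(2)[of A "join v 0"] assms by (simp add: sym_pos_def_def inner_join)
  finally show ?thesis
    using v(1) by (simp add: mult_le_cancel_right_pos)
qed

section \<open>The reduced cost function\<close>

lemma quad_fun_fixed_upper_part:
  assumes "sym_pos_def A"
  shows "quad_fun A b c (join x y) =
    quad_fun (block22 A) (lower_part b - block21 A *v x) (quad_fun A b c (join x 0)) y"
proof -
  have "join x y = join x 0 + join 0 y"
    by (simp add: join_add)
  moreover have "transpose A = A"
    using assms by (simp add: sym_pos_def_def)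
  moreover have "b \<bullet> join 0 y = lower_part b \<bullet> y"
    by (metis join_parts inner_join inner_zero_right add_0)
  moreover have "join 0 y \<bullet> (A *v join x 0) = (block21 A *v x) \<bullet> y"
    "join 0 y \<bullet> (A *v join 0 y) = y \<bullet> (block22 A *v y)"
    by (simp_all add: matrix_mult_join inner_join inner_commute)
  ultimately show ?thesis
    by (simp add: quad_fun_def quadratic_form_add inner_add_right inner_diff_left)
qed

lemma GDERIV_inner_eq_0_iff:
  assumes "sym_pos_def A"
  shows "GDERIV (\<lambda>y'. quad_fun A b c (join x y')) y :> 0 \<longleftrightarrow> y = inner_sol A b x"
proof -
  let ?g = "lower_part b - block21 A *v x"
  have "(\<lambda>y'. quad_fun A b c (join x y')) = quad_fun (block22 A) ?g (quad_fun A b c (join x 0))"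
    by (intro ext quad_fun_fixed_upper_part assms)
  moreover have "transpose (block22 A) = block22 A"
    using sym_pos_def_block22[OF assms] by (simp add: sym_pos_def_def)
  ultimately have "GDERIV (\<lambda>y'. quad_fun A b c (join x y')) y :> block22 A *v y - ?g"
    by (simp only: GDERIV_quad_fun)
  then have "GDERIV (\<lambda>y'. quad_fun A b c (join x y')) y :> 0 \<longleftrightarrow> block22 A *v y = ?g"
    using GDERIV_unique by fastforce
  also have "\<dots> \<longleftrightarrow> y = matrix_inv (block22 A) *v ?g"
    by (metis matrix_inv_block22[OF assms])
  also have "matrix_inv (block22 A) *v ?g = inner_sol A b x"
    by (simp add: inner_sol_def matrix_vector_mult_diff_distrib)
  finally show ?thesis .
qed

text \<open>The graph of \<open>h\<close> is the graph of the extension shifted by \<open>(0, A\<^sub>2\<^sub>2\<^sup>-\<^sup>1 b\<^sub>2)\<close>. The shift is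
  \<open>A\<close>-orthogonal to every extension, so it changes only the constant, and the linear term comes
  from \<open>b\<close> alone.\<close>

lemma reduced_cost_eq_quad_fun:
  assumes "sym_pos_def A"
  shows "\<exists>g d. reduced_cost A b c = quad_fun (schur_compl A) g d"
proof -
  define p where "p = join (0::real^'a) (matrix_inv (block22 A) *v lower_part b)"
  define K where "K = matrix_inv (block22 A) ** block21 A"
  define g where "g = upper_part b - transpose K *v lower_part b"
  have sym: "transpose A = A"
    using assms by (simp add: sym_pos_def_def)
  have "reduced_cost A b c x = quad_fun (schur_compl A) g (quad_fun A b c p) x" for x
  proof -
    let ?e = "schur_extension A x"
    have "join x (inner_sol A b x) = ?e + p"
      by (simp add: inner_sol_def schur_extension_def p_def join_add)
    moreover have "(?e + p) \<bullet> (A *v (?e + p)) = x \<bullet> (schur_compl A *v x) + p \<bullet> (A *v p)"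
    proof -
      have "p \<bullet> (A *v ?e) = 0"
        by (simp add: matrix_mult_schur_extension[OF assms] p_def inner_join)
      then show ?thesis
        by (simp only: quadratic_form_add[OF sym] inner_schur_compl[OF assms])
    qed
    moreover have "b \<bullet> ?e = g \<bullet> x"
    proof -
      have "b \<bullet> ?e = join (upper_part b) (lower_part b) \<bullet> join x (- (K *v x))"
        by (simp add: join_parts schur_extension_def K_def matrix_vector_mul_assoc)
      also have "\<dots> = g \<bullet> x"
        by (simp add: inner_join g_def inner_diff_left dot_lmul_matrix)
      finally show ?thesis .
    qed
    ultimately show ?thesis
      by (simp add: reduced_cost_def quad_fun_def inner_add_right)
  qed
  then show ?thesis by blast
qed

theorem proposition1:
  fixes A :: "real^('m::finite + 'n::finite)^('m + 'n)"
    and b :: "real^('m + 'n)"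
    and c :: real
  assumes "sym_pos_def A"
  shows "(\<forall>x y. GDERIV (\<lambda>y'. quad_fun A b c (join x y')) y :> 0 \<longleftrightarrow> y = inner_sol A b x)
    \<and> is_quadratic (reduced_cost A b c)
    \<and> (\<forall>x. has_hessian (reduced_cost A b c) (schur_compl A) x)
    \<and> has_gd_rate (quad_fun A b c) (gd_factor A)
    \<and> has_gd_rate (reduced_cost A b c) (gd_factor (schur_compl A))
    \<and> gd_factor (schur_compl A) \<le> gd_factor A"
proof -
  note S = sym_pos_def_schur_compl[OF assms]
  obtain g d where J: "reduced_cost A b c = quad_fun (schur_compl A) g d"
    using reduced_cost_eq_quad_fun[OF assms] by blast
  have "is_quadratic (reduced_cost A b c)"
    unfolding is_quadratic_def using J by blast
  moreover have "has_hessian (reduced_cost A b c) (schur_compl A) x" for x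
    unfolding J using S by (intro has_hessian_quad_fun) (simp add: sym_pos_def_def)
  moreover have "has_gd_rate (reduced_cost A b c) (gd_factor (schur_compl A))"
    unfolding J by (rule has_gd_rate_quad_fun[OF S])
  moreover have "gd_factor (schur_compl A) \<le> gd_factor A"
    by (intro gd_factor_mono S assms lambda_min_le_schur_compl lambda_max_schur_compl_le)
  ultimately show ?thesis
    using GDERIV_inner_eq_0_iff[OF assms] has_gd_rate_quad_fun[OF assms] by blast
qed

end
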